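(* There are infinitely many positive integers $n$ such that $$L(n) < \left(\frac{1}{\log 2}+o(1)\right)\log\log n,$$ where $o(1)$ denotes a quantity tending to $0$ as $n\to\infty$ through these integers.
   Context: $\lambda$ is Carmichael's function: $\lambda(n)$ is the order of the largest cyclic subgroup of $(\mathbb{Z}/n\mathbb{Z})^\times$. Let $\lambda_k$ denote the $k$-th iterate of $\lambda$ (with $\lambda_0(n)=n$). $L(n)$ is the smallest nonnegative integer $k$ such that $\lambda_k(n)=1$. Here $\log$ is the natural logarithm. *)

theory Defs
  imports Complex_Main "HOL-Number_Theory.Number_Theory"
begin

text \<open>
  The library introduces \<^const>\<open>Carmichael\<close> as the least common multiple of the orders of all
  units modulo \<open>n\<close>.  The next lemma shows that it is the order of a largest cyclic subgroup of
  the unit group.  The case \<open>n = 1\<close>, where the unit group is trivial and \<open>Carmichael 1 = 1\<close>,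
  is left out because \<^const>\<open>residue_ring\<close> is a ring with \<open>1\<close> in its carrier only for moduli
  greater than \<open>1\<close>.
\<close>

lemma Carmichael_eq_Max_cyclic_subgroup:
  fixes n :: nat
  assumes n: "n > 1"
  defines "G \<equiv> units_of (residue_ring (int n))"
  shows "Carmichael n =
    Max {card H | H. subgroup H G \<and> (\<exists>x\<in>carrier G. H = generate G {x})}"
proof -
  interpret R: residues "int n" "residue_ring (int n)"
    using n by unfold_locales auto
  interpret G: group G
    unfolding G_def by (rule R.units_group)
  have carrier: "carrier G = int ` totatives n"
  proof -
    have "carrier G = {x. 0 < x \<and> x < int n \<and> coprime x (int n)}"
      by (simp add: G_def units_of_carrier R.res_units_eq)
    also have "\<dots> = int ` totatives n"
    proof (intro equalityI subsetI)
      fix x assume "x \<in> {x. 0 < x \<and> x < int n \<and> coprime x (int n)}"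
      then have x: "0 < x" "x < int n" "coprime x (int n)" by auto
      then have "x = int (nat x)" by simp
      moreover have "coprime (int (nat x)) (int n)" using x by simp
      then have "coprime (nat x) n" by (simp only: coprime_int_iff)
      with x have "nat x \<in> totatives n" by (auto simp: totatives_def)
      ultimately show "x \<in> int ` totatives n" by blast
    next
      fix x assume "x \<in> int ` totatives n"
      then obtain y where y: "x = int y" "y \<in> totatives n" by auto
      then have "y < n" using n totatives_less[of y n] by simp
      with y show "x \<in> {x. 0 < x \<and> x < int n \<and> coprime x (int n)}"
        by (auto simp: totatives_def)
    qed
    finally show ?thesis .
  qed
  have ord_eq: "group.ord G (int a) = ord n a" if a: "a \<in> totatives n" for a
  proof -
    have a_in: "int a \<in> carrier G" using a carrier by auto
    have "a < n" using n a totatives_less[of a n] by simp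
    have pow: "int a [^]\<^bsub>G\<^esub> k = int (a ^ k mod n)" for k :: nat
    proof -
      have "int a [^]\<^bsub>G\<^esub> k = int a [^]\<^bsub>residue_ring (int n)\<^esub> k"
        unfolding G_def by (rule R.units_of_pow) (use a_in in \<open>simp add: G_def units_of_carrier\<close>)
      also have "\<dots> = int a ^ k mod int n"
        using R.pow_cong[of "int a" k] \<open>a < n\<close> by simp
      finally show ?thesis by (simp add: zmod_int)
    qed
    have one: "\<one>\<^bsub>G\<^esub> = int 1" by (simp add: G_def units_of_one R.res_one_eq)
    have "group.ord G (int a) dvd k \<longleftrightarrow> ord n a dvd k" for k
    proof -
      have "group.ord G (int a) dvd k \<longleftrightarrow> int a [^]\<^bsub>G\<^esub> k = \<one>\<^bsub>G\<^esub>"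
        using G.pow_eq_id[OF a_in] by simp
      also have "\<dots> \<longleftrightarrow> a ^ k mod n = 1" unfolding pow one by (simp only: of_nat_eq_iff)
      also have "\<dots> \<longleftrightarrow> [a ^ k = 1] (mod n)" using n by (simp add: cong_def)
      also have "\<dots> \<longleftrightarrow> ord n a dvd k" by (rule ord_divides)
      finally show ?thesis .
    qed
    then show ?thesis by (meson dvd_antisym dvd_refl)
  qed
  have "{card H | H. subgroup H G \<and> (\<exists>x\<in>carrier G. H = generate G {x})}
      = (\<lambda>x. card (generate G {x})) ` carrier G"
    by (auto intro!: G.generate_is_subgroup)
  also have "\<dots> = group.ord G ` carrier G"
    by (intro image_cong refl) (simp add: G.generate_pow_card)
  also have "\<dots> = ord n ` totatives n"
    unfolding carrier image_image by (intro image_cong refl) (simp add: ord_eq)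
  finally show ?thesis
    using n by (simp add: Carmichael_altdef)
qed

definition L :: "nat \<Rightarrow> nat" where
  "L n = (LEAST k. (Carmichael ^^ k) n = 1)"

text \<open>For positive \<open>n\<close> the iteration does reach \<open>1\<close>, so the minimum exists.\<close>

lemma funpow_Carmichael_reaches_1:
  assumes "n > 0"
  shows "\<exists>k. (Carmichael ^^ k) n = 1"
  using assms
proof (induction n rule: less_induct)
  case (less n)
  show ?case
  proof (cases "n = 1")
    case True
    then show ?thesis by (intro exI[of _ 0]) simp
  next
    case False
    with less.prems have n: "n > 1" by simp
    have "Carmichael n \<le> totient n"
      using less.prems by (intro dvd_imp_le Carmichael_dvd_totient) simp
    also have "totient n < n" using n by (rule totient_less)
    finally obtain k where "(Carmichael ^^ k) (Carmichael n) = 1"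
      using less.IH[of "Carmichael n"] by auto
    then show ?thesis
      by (intro exI[of _ "Suc k"]) (simp only: funpow_Suc_right o_apply)
  qed
qed

end

theory Submission
  imports Defs
begin

text \<open>
  The witnesses are \<open>n = lcm(1, \<dots>, 2\<^sup>j)\<close>. The prime powers dividing such an \<open>n\<close> are at most
  \<open>2\<^sup>j\<close>, and each application of \<open>\<lambda>\<close> halves that bound. By the closed formula for \<open>\<lambda>\<close>, a prime
  power dividing \<open>\<lambda>(n)\<close> divides either \<open>r\<^sup>k\<^sup>-\<^sup>1\<close> with \<open>r\<^sup>k\<close> dividing \<open>n\<close>, where a factor
  \<open>r \<ge> 2\<close> has been lost, or \<open>r - 1\<close> for an odd prime \<open>r\<close> dividing \<open>n\<close>. In the second case the
  number \<open>r - 1\<close> is even, so an odd prime power dividing it is at most half of it. Only powers of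
  \<open>2\<close> escape the halving, and for them it suffices to allow a bound twice as large throughout
  (\<open>power_smooth\<close>, \<open>power_smooth_Carmichael\<close>). After \<open>j\<close> steps a divisor of \<open>2\<close> is left, so that
  \<open>L(n) \<le> j + 1\<close>.

  In the other direction \<open>n\<close> is large: Leibniz' harmonic triangle shows that
  \<open>(2 m + 1) (2 m choose m)\<close> divides \<open>lcm(1, \<dots>, 2 m + 1)\<close>, whence \<open>n \<ge> 4\<^sup>m\<close> for \<open>2 m + 2 = 2\<^sup>j\<close>,
  and \<open>ln (ln n) \<ge> j ln 2 - O(1)\<close>. Together these give \<open>L(n) \<le> ln (ln n) / ln 2 + O(1)\<close>.
\<close>

section \<open>Prime powers dividing iterated Carmichael values\<close>

text \<open>
  The bound for powers of \<open>2\<close> is doubled because \<open>2\<^sup>a\<close> may divide \<open>r - 1\<close> for a Fermat prime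
  \<open>r = 2\<^sup>a + 1\<close>, where the passage from \<open>r\<close> to \<open>r - 1\<close> loses almost nothing.
\<close>

definition power_smooth :: "nat \<Rightarrow> nat \<Rightarrow> bool" where
  "power_smooth j n \<longleftrightarrow>
     (\<forall>p a. prime p \<longrightarrow> p ^ a dvd n \<longrightarrow> p ^ a \<le> (if p = 2 then 2 ^ Suc j else 2 ^ j))"

lemma power_smoothD:
  assumes "power_smooth j n" "prime p" "p ^ a dvd n"
  shows "p ^ a \<le> (if p = 2 then 2 ^ Suc j else 2 ^ j)"
  using assms unfolding power_smooth_def by blast

lemma prime_power_dvd_Lcm:
  fixes A :: "nat set"
  assumes "finite A" "0 \<notin> A" "prime p" "p ^ a dvd Lcm A" "a > 0"
  shows "\<exists>x\<in>A. p ^ a dvd x"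
  using assms(1,2,4)
proof (induction A rule: finite_induct)
  case empty
  then show ?case using assms(3,5) by (auto simp: prime_nat_iff)
next
  case (insert x A)
  have nz: "x \<noteq> 0" "Lcm A \<noteq> 0" using insert by (auto simp: Lcm_0_iff)
  have p: "\<not> is_unit p" using assms(3) by (auto simp: prime_nat_iff)
  have "a \<le> multiplicity p (lcm x (Lcm A))"
    using insert.prems nz p by (intro multiplicity_geI) (auto simp: lcm_eq_0_iff)
  also have "\<dots> = max (multiplicity p x) (multiplicity p (Lcm A))"
    using nz assms(3) by (intro multiplicity_lcm) auto
  finally have "a \<le> multiplicity p x \<or> a \<le> multiplicity p (Lcm A)" by linarith
  then have "p ^ a dvd x \<or> p ^ a dvd Lcm A" by (auto intro: multiplicity_dvd')
  then show ?case using insert by auto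
qed

lemma prime_power_dvd_prime_power:
  fixes p r :: nat
  assumes "prime p" "prime r" "a > 0" "p ^ a dvd r ^ k"
  shows "p = r \<and> a \<le> k"
proof -
  have "p dvd r ^ k" using assms(3,4) by (meson dvd_power dvd_trans)
  then have "p = r" using assms(1,2) prime_dvd_power primes_dvd_imp_eq by blast
  moreover from this have "a \<le> k"
    using assms by (metis power_dvd_imp_le prime_gt_1_nat)
  ultimately show ?thesis by simp
qed

lemma prime_power_dvd_mult_coprime:
  fixes p :: nat
  assumes "prime p" "coprime x y" "p ^ a dvd x * y"
  shows "p ^ a dvd x \<or> p ^ a dvd y"
proof (cases "p dvd x")
  case True
  with assms(1,2) have "\<not> p dvd y"
    by (meson coprime_common_divisor not_prime_unit)
  then have "coprime (p ^ a) y" using assms(1) by (simp add: prime_imp_coprime)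
  then show ?thesis using assms(3) by (simp add: coprime_dvd_mult_left_iff)
next
  case False
  then have "coprime (p ^ a) x" using assms(1) by (simp add: prime_imp_coprime)
  then show ?thesis using assms(3) by (simp add: coprime_dvd_mult_right_iff)
qed

lemma prime_power_dvd_Carmichael:
  assumes "prime p" "a > 0" "p ^ a dvd Carmichael n"
  obtains r k where "prime r" "k > 0" "r ^ k dvd n" "p ^ a dvd Carmichael (r ^ k)"
proof -
  define f where "f = (\<lambda>r. Carmichael (r ^ multiplicity r n))"
  have "f r = (let k = multiplicity r n in
                 if r = 2 \<and> k > 2 then 2 ^ (k - 2) else r ^ (k - 1) * (r - 1))"
    if "r \<in> prime_factors n" for r
    using that unfolding f_def Let_def
    by (intro Carmichael_prime_power) (auto simp: prime_factors_multiplicity)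
  then have "Carmichael n = Lcm (f ` prime_factors n)"
    using Carmichael_closed_formula[of n] by (simp cong: image_cong)
  with assms have "p ^ a dvd Lcm (f ` prime_factors n)" by simp
  moreover have "0 \<notin> f ` prime_factors n" unfolding f_def using Carmichael_nonzero by fastforce
  ultimately obtain r where r: "r \<in> prime_factors n" "p ^ a dvd f r"
    using prime_power_dvd_Lcm[of "f ` prime_factors n" p a] assms by auto
  show thesis
    by (rule that[of r "multiplicity r n"])
       (use r in \<open>auto simp: f_def multiplicity_dvd prime_factors_multiplicity\<close>)
qed

text \<open>
  For an odd prime power \<open>p\<^sup>a\<close> dividing \<open>r - 1\<close> the bound is halved because \<open>2 p\<^sup>a\<close> divides
  \<open>r - 1\<close> as well. For \<open>p = 2\<close> the slack of \<open>power_smooth\<close> makes \<open>2\<^sup>a < r \<le> 2\<^sup>j\<^sup>+\<^sup>1\<close> sufficient.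
\<close>

lemma power_smooth_Carmichael:
  assumes "power_smooth (Suc j) n"
  shows "power_smooth j (Carmichael n)"
  unfolding power_smooth_def
proof (intro allI impI)
  fix p a :: nat
  assume p: "prime p" and dvd: "p ^ a dvd Carmichael n"
  show "p ^ a \<le> (if p = 2 then 2 ^ Suc j else 2 ^ j)"
  proof (cases "a = 0")
    case False
    then have a: "a > 0" by simp
    from prime_power_dvd_Carmichael[OF p a dvd]
    obtain r k where r: "prime r" "k > 0" "r ^ k dvd n" "p ^ a dvd Carmichael (r ^ k)" .
    note bound = power_smoothD[OF assms r(1,3)]
    show ?thesis
    proof (cases "r = 2")
      case True
      define e where "e = (if k \<le> 2 then k - 1 else k - 2)"
      have "p ^ a dvd 2 ^ e" using r(4) True by (auto simp: Carmichael_twopow e_def)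
      then have pa: "p = 2" "a \<le> e"
        using prime_power_dvd_prime_power[of p 2 a e] p a by auto
      from bound True have "(2::nat) ^ k \<le> 2 ^ Suc (Suc j)" by simp
      then have "k \<le> Suc (Suc j)" by (rule power_le_imp_le_exp[rotated]) simp
      then have "e \<le> Suc j" by (auto simp: e_def)
      with pa have "(2::nat) ^ a \<le> 2 ^ Suc j" by (intro power_increasing) auto
      with pa show ?thesis by simp
    next
      case False
      with r have "odd r" "r \<ge> 3"
        using prime_odd_nat[of r] prime_ge_2_nat[of r] by force+
      have "p ^ a dvd r ^ (k - 1) * (r - 1)"
        using r \<open>odd r\<close> by (simp add: Carmichael_odd_prime_power)
      moreover have "coprime (r ^ (k - 1)) (r - 1)"
        using \<open>r \<ge> 3\<close> by (intro coprime_power_left_iff[THEN iffD2] disjI1 coprime_diff_one_right_nat) simp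
      ultimately consider "p ^ a dvd r ^ (k - 1)" | "p ^ a dvd r - 1"
        using prime_power_dvd_mult_coprime[OF p] by blast
      then show ?thesis
      proof cases
        case 1
        then have pr: "p = r" "a \<le> k - 1"
          using prime_power_dvd_prime_power[OF p r(1) a] by auto
        have "2 * p ^ a \<le> r * r ^ (k - 1)"
          using pr \<open>r \<ge> 3\<close> by (intro mult_mono) (auto intro: power_increasing)
        also have "\<dots> = r ^ k" using r(2) by (cases k) auto
        also have "\<dots> \<le> 2 * 2 ^ j" using bound False by simp
        finally have "p ^ a \<le> 2 ^ j" "p ^ a \<le> 2 ^ Suc j" by simp_all
        then show ?thesis by metis
      next
        case 2
        have "r ^ 1 dvd n" using r(2,3) by (metis One_nat_def Suc_leI power_le_dvd)
        from power_smoothD[OF assms r(1) this] False have rj: "r \<le> 2 * 2 ^ j" by simp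
        show ?thesis
        proof (cases "p = 2")
          case True
          have "p ^ a \<le> r - 1" using 2 \<open>r \<ge> 3\<close> by (intro dvd_imp_le) auto
          with rj True show ?thesis by simp
        next
          case False
          then have "odd p" using p by (metis primes_dvd_imp_eq two_is_prime_nat)
          then have "coprime 2 (p ^ a)" by simp
          then have "2 * p ^ a dvd r - 1"
            using 2 \<open>odd r\<close> by (intro divides_mult) auto
          then have "2 * p ^ a \<le> r - 1" using \<open>r \<ge> 3\<close> by (intro dvd_imp_le) auto
          with rj False show ?thesis by simp
        qed
      qed
    qed
  qed auto
qed

lemma power_smooth_0_imp_Carmichael_eq_1:
  assumes "power_smooth 0 n" "n > 0"
  shows "Carmichael n = 1"
proof (rule ccontr)
  assume "Carmichael n \<noteq> 1"
  then obtain p where p: "prime p" "p ^ 1 dvd Carmichael n"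
    by (metis power_one_right prime_factor_nat)
  from prime_power_dvd_Carmichael[OF p(1) _ p(2)]
  obtain r k where r: "prime r" "k > 0" "r ^ k dvd n" "p ^ 1 dvd Carmichael (r ^ k)" by auto
  have "r ^ k \<le> (if r = 2 then 2 else 1)"
    using power_smoothD[OF assms(1) r(1,3)] by (simp split: if_splits)
  moreover have "r ^ k > 1" using r prime_gt_1_nat by (metis one_less_power)
  ultimately have "r ^ k = 2" by (auto split: if_splits)
  with r(4) p(1) show False by (simp add: prime_nat_iff)
qed

lemma L_le_of_power_smooth:
  assumes "power_smooth j n" "n > 0"
  shows "L n \<le> Suc j"
proof -
  have "(Carmichael ^^ Suc j) n = 1"
    using assms
  proof (induction j arbitrary: n)
    case 0
    then show ?case by (simp add: power_smooth_0_imp_Carmichael_eq_1 del: One_nat_def)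
  next
    case (Suc j)
    then have "(Carmichael ^^ Suc j) (Carmichael n) = 1"
      by (intro Suc.IH power_smooth_Carmichael) auto
    then show ?case by (simp only: funpow_Suc_right o_apply)
  qed
  then show ?thesis unfolding L_def by (rule Least_le)
qed

lemma power_smooth_Lcm: "power_smooth j (Lcm {1..2 ^ j})"
  unfolding power_smooth_def
proof (intro allI impI)
  fix p a :: nat
  assume p: "prime p" "p ^ a dvd Lcm {1..2 ^ j}"
  have "p ^ a \<le> 2 ^ j"
  proof (cases "a = 0")
    case False
    then obtain x where "x \<in> {1..2 ^ j}" "p ^ a dvd x"
      using prime_power_dvd_Lcm[of "{1..2 ^ j}" p a] p by auto
    then show ?thesis using dvd_imp_le[of "p ^ a" x] by auto
  qed simp
  then show "p ^ a \<le> (if p = 2 then 2 ^ Suc j else 2 ^ j)"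
    by (auto intro: order.trans)
qed

section \<open>A lower bound for the least common multiple of an initial segment\<close>

text \<open>
  The numbers \<open>1 / ((n + 1) (n choose k))\<close> form Leibniz' harmonic triangle, in which every entry is
  the sum of the two entries below it.
\<close>

lemma leibniz_triangle:
  assumes "k \<le> n"
  shows "1 / (real (Suc (Suc n)) * real (Suc n choose Suc k)) =
         1 / (real (Suc n) * real (n choose k)) -
         1 / (real (Suc (Suc n)) * real (Suc n choose k))"
proof -
  define c where "c = real (n choose k)"
  define s t where "s = real (Suc k)" and "t = real (Suc n - k)"
  have pos: "c > 0" "s > 0" "t > 0" using assms by (auto simp: c_def s_def t_def)
  have n: "real (Suc n) = s + t - 1" "real (Suc (Suc n)) = s + t"
    using assms by (auto simp: s_def t_def)
  have "real (Suc k * (Suc n choose Suc k)) = real (Suc n * (n choose k))"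
    by (simp only: Suc_times_binomial)
  then have a: "real (Suc n choose Suc k) = (s + t - 1) * c / s"
    using pos unfolding of_nat_mult n s_def[symmetric] c_def[symmetric] by (simp add: field_simps)
  have "(Suc n - k) * (Suc n choose k) = Suc n * (n choose k)"
    using binomial_absorb_comp[of "Suc n" k] by simp
  then have "real ((Suc n - k) * (Suc n choose k)) = real (Suc n * (n choose k))"
    by (simp only:)
  then have b: "real (Suc n choose k) = (s + t - 1) * c / t"
    using pos unfolding of_nat_mult n t_def[symmetric] c_def[symmetric] by (simp add: field_simps)
  have "s + t - 1 > 0" using n(1) by (metis of_nat_0_less_iff zero_less_Suc)
  then show ?thesis
    unfolding a b c_def[symmetric] n using pos
    by (simp add: divide_simps)
qed

text \<open>
  The first \<open>n + 1\<close> rows of Leibniz' triangle arise from their edge entries \<open>1, 1 / 2, \<dots>, 1 / (n + 1)\<close>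
  by subtractions. Multiplication by \<open>D\<close> turns the edge entries into integers, hence all entries.
\<close>

lemma mult_binomial_dvd:
  fixes D :: nat
  assumes "\<And>i. 1 \<le> i \<Longrightarrow> i \<le> Suc n \<Longrightarrow> i dvd D" and "k \<le> n"
  shows "Suc n * (n choose k) dvd D"
proof -
  have "real D / (real (Suc n) * real (n choose k)) \<in> \<int>"
    using assms
  proof (induction k arbitrary: n)
    case 0
    then have "Suc n dvd D" by simp
    then obtain e where "D = Suc n * e" ..
    then have "real D / (real (Suc n) * real (n choose 0)) = real e"
      by (simp del: of_nat_Suc mult_Suc)
    then show ?case by simp
  next
    case (Suc k)
    from \<open>Suc k \<le> n\<close> obtain m where m: "n = Suc m" "k \<le> m" by (cases n) auto
    have "real D / (real (Suc n) * real (n choose Suc k)) =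
          real D / (real (Suc m) * real (m choose k)) -
          real D / (real (Suc n) * real (n choose k))"
      using arg_cong[OF leibniz_triangle[OF m(2)], of "\<lambda>x. real D * x"] m(1)
      by (simp only: right_diff_distrib times_divide_eq_right mult_1_right)
    also have "\<dots> \<in> \<int>"
      using Suc.prems m by (intro Ints_diff Suc.IH) auto
    finally show ?case .
  qed
  then have "real D / real (Suc n * (n choose k)) \<in> \<int>" by (simp only: of_nat_mult)
  then obtain z :: int where z: "real D / real (Suc n * (n choose k)) = of_int z"
    by (elim Ints_cases)
  have "real (Suc n * (n choose k)) \<noteq> 0"
    unfolding of_nat_eq_0_iff using assms(2) by simp
  with z have "real_of_int (int D) = real_of_int (int (Suc n * (n choose k)) * z)"
    by (simp only: of_int_mult of_int_of_nat_eq) (simp add: field_simps)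
  then have "int D = int (Suc n * (n choose k)) * z" by (simp only: of_int_eq_iff)
  then show ?thesis by (metis dvd_triv_left int_dvd_int_iff)
qed

lemma Lcm_lower_bound:
  assumes "2 * m + 1 \<le> N"
  shows "4 ^ m \<le> Lcm {1..N}"
proof (cases "m = 0")
  case True
  have "Lcm {1..N} > 0" by (auto simp: Lcm_0_iff intro: Nat.gr0I)
  with True show ?thesis by (simp add: Suc_le_eq)
next
  case False
  have "4 ^ m / (2 * real m) \<le> real (2 * m choose m)"
    using False by (intro central_binomial_lower_bound) simp
  then have "real (4 ^ m) \<le> real (2 * m * (2 * m choose m))"
    using False by (simp add: field_simps)
  then have "4 ^ m \<le> 2 * m * (2 * m choose m)" by (simp only: of_nat_le_iff)
  also have "\<dots> \<le> Suc (2 * m) * (2 * m choose m)" by simp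
  also have "\<dots> \<le> Lcm {1..N}"
  proof (rule dvd_imp_le)
    show "Suc (2 * m) * (2 * m choose m) dvd Lcm {1..N}"
      using assms by (intro mult_binomial_dvd) auto
    show "Lcm {1..N} > 0" by (auto simp: Lcm_0_iff intro: Nat.gr0I)
  qed
  finally show ?thesis .
qed

lemma ln_ln_Lcm_lower_bound:
  assumes "j \<ge> 2"
  shows "(real j - 2) * ln 2 \<le> ln (ln (real (Lcm {1..2 ^ j})))"
proof -
  from assms obtain i where j: "j = Suc (Suc i)" by (metis add_2_eq_Suc le_Suc_ex)
  \<comment> \<open>the largest \<open>m\<close> with \<open>2 m + 1 \<le> 2\<^sup>j\<close>\<close>
  define m :: nat where "m = 2 * 2 ^ i - 1"
  have "m \<ge> 2 ^ i" using one_le_power[of "2::nat" i] by (simp add: m_def)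
  have "4 ^ m \<le> Lcm {1..2 ^ j :: nat}"
    using one_le_power[of "2::nat" i] unfolding m_def j power_Suc
    by (intro Lcm_lower_bound) linarith
  then have le: "4 ^ m \<le> real (Lcm {1..2 ^ j})"
    by (metis of_nat_le_iff of_nat_numeral of_nat_power)
  have "exp 1 \<le> (4::real)" using exp_le by simp
  then have ln4: "1 \<le> ln (4::real)" by (simp add: ln_ge_iff)
  have "2 ^ i * 1 \<le> real m * ln 4"
    using \<open>m \<ge> 2 ^ i\<close> ln4 by (intro mult_mono) (auto simp flip: of_nat_le_iff)
  also have "\<dots> = ln (4 ^ m)" by (simp add: ln_realpow)
  also have "\<dots> \<le> ln (real (Lcm {1..2 ^ j}))"
    using le by (intro ln_mono) (auto intro: less_le_trans[OF _ le])
  finally have ln: "2 ^ i \<le> ln (real (Lcm {1..2 ^ j}))" by simp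
  have "(real j - 2) * ln 2 = ln (2 ^ i)" by (simp add: ln_realpow j)
  also have "\<dots> \<le> ln (ln (real (Lcm {1..2 ^ j})))"
    using ln by (intro ln_mono) (auto intro: less_le_trans[OF _ ln])
  finally show ?thesis .
qed

section \<open>The upper bound for the number of iterations\<close>

theorem theorem4:
  shows "\<exists>(S :: nat set) (\<epsilon> :: nat \<Rightarrow> real).
    infinite S \<and> (\<forall>n\<in>S. n > 0) \<and>
    (\<epsilon> \<longlongrightarrow> 0) (inf at_top (principal S)) \<and>
    (\<forall>n\<in>S. real (L n) < (1 / ln 2 + \<epsilon> n) * ln (ln (real n)))"
proof -
  define N where "N j = Lcm {1..2 ^ j :: nat}" for j
  define S where "S = N ` {3..}"
  \<comment> \<open>\<open>4\<close> exceeds the difference between \<open>j + 1 \<ge> L n\<close> and \<open>j - 2 \<le> ln (ln n) / ln 2\<close>\<close>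
  define \<epsilon> where "\<epsilon> n = 4 / ln (ln (real n))" for n
  have N_pos: "N j > 0" for j unfolding N_def by (auto simp: Lcm_0_iff intro: Nat.gr0I)
  have N_ge: "2 ^ j \<le> N j" for j
    unfolding N_def by (rule dvd_imp_le) (use N_pos in \<open>auto simp: N_def\<close>)

  have "infinite S"
    unfolding infinite_nat_iff_unbounded_le
  proof
    fix m :: nat
    have "m < 2 ^ m" by (rule less_exp)
    also have "\<dots> \<le> (2::nat) ^ (m + 3)" by (intro power_increasing) auto
    also have "\<dots> \<le> N (m + 3)" by (rule N_ge)
    finally show "\<exists>n\<ge>m. n \<in> S" by (auto simp: S_def intro: less_imp_le)
  qed
  moreover have "\<forall>n\<in>S. n > 0" using N_pos by (auto simp: S_def)
  moreover have "(\<epsilon> \<longlongrightarrow> 0) (inf at_top (principal S))"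
  proof -
    have "filterlim (\<lambda>n. ln (ln (real n))) at_top at_top"
      by (intro filterlim_compose[OF ln_at_top] filterlim_real_sequentially)
    then have "(\<epsilon> \<longlongrightarrow> 0) at_top"
      unfolding \<epsilon>_def by (intro tendsto_divide_0[OF tendsto_const] filterlim_at_top_imp_at_infinity)
    then show ?thesis by (rule tendsto_mono[rotated]) simp
  qed
  moreover have "\<forall>n\<in>S. real (L n) < (1 / ln 2 + \<epsilon> n) * ln (ln (real n))"
  proof
    fix n assume "n \<in> S"
    then obtain j where j: "j \<ge> 3" "n = N j" by (auto simp: S_def)
    have lower: "(real j - 2) * ln 2 \<le> ln (ln (real n))"
      using ln_ln_Lcm_lower_bound[of j] j by (simp add: N_def)
    have "0 < (real j - 2) * ln 2" using j by simp
    with lower have pos: "ln (ln (real n)) > 0" by linarith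
    have "L n \<le> Suc j"
      using j N_pos power_smooth_Lcm by (intro L_le_of_power_smooth) (auto simp: N_def)
    then have "real (L n) < (real j - 2) + 4" by simp
    also have "real j - 2 \<le> ln (ln (real n)) / ln 2"
      using lower by (simp add: field_simps)
    also have "ln (ln (real n)) / ln 2 + 4 = (1 / ln 2 + \<epsilon> n) * ln (ln (real n))"
      using pos by (simp add: \<epsilon>_def distrib_right)
    finally show "real (L n) < (1 / ln 2 + \<epsilon> n) * ln (ln (real n))" by simp
  qed
  ultimately show ?thesis by blast
qed

end
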